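(* Let $X$ and $Y$ be two Banach spaces and let $G:X\longrightarrow Y$ be a Daugavet center such that $G(X)$ is separable. If $\operatorname{dens}(Y)=\omega_1$ then, for every $u\in B_{X^{**}}$ and every $\{g_n:n\in\mathbb N\}\subseteq S_{X^*}$, there exists $v\in B_{X^{**}}$ such that (1) $v(g_n)=u(g_n)$ holds for every $n\in\mathbb N$, and (2) $\|G^{**}(v)+y\|=1+\|y\|$ holds for every $y\in Y$. In particular, given any non-empty relatively $w^*$-open subset $W$ of $B_{X^{**}}$ there exists $v\in W$ satisfying (2).
   Context: All Banach spaces are real. $B_X$ and $S_X$ denote the closed unit ball and the unit sphere of $X$. $Y$ is regarded as a subspace of $Y^{**}$ via the canonical embedding, and $G^{**}:X^{**}\to Y^{**}$ is the biadjoint of $G$. $\operatorname{dens}(Y)$ is the density character of $Y$, i.e. the least cardinality of a norm-dense subset of $Y$; $\omega_1$ is the first uncountable ordinal (identified with its cardinal). A bounded linear operator $G:X\to Y$ is a Daugavet center if $\|G+T\|=\|G\|+\|T\|$ holds for every rank-one operator $T:X\to Y$.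
   Formalization: The formal theorem adds the hypothesis ‖G‖ = 1; with the constant 1 in (2) the claim as printed fails for every Daugavet center with ‖G‖ ≠ 1 (for G = 0, condition (2) at y = 0 reads 0 = 1). *)

theory Defs
  imports "HOL-Analysis.Analysis"
begin

unbundle cardinal_syntax

type_synonym 'a dual = "'a \<Rightarrow>\<^sub>L real"
type_synonym 'a bidual = "'a dual \<Rightarrow>\<^sub>L real"

lift_definition canonical_embedding :: "'a::real_normed_vector \<Rightarrow> 'a bidual"
  is "\<lambda>y f. blinfun_apply f y"
  by (rule blinfun.bounded_linear_left)

lift_definition adjoint_op ::
    "('a::real_normed_vector \<Rightarrow>\<^sub>L 'b::real_normed_vector) \<Rightarrow> ('b dual \<Rightarrow>\<^sub>L 'a dual)"
  is "\<lambda>G f. f o\<^sub>L G"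
  by (rule bounded_bilinear.bounded_linear_left[OF bounded_bilinear_blinfun_compose])

definition biadjoint ::
    "('a::real_normed_vector \<Rightarrow>\<^sub>L 'b::real_normed_vector) \<Rightarrow> ('a bidual \<Rightarrow>\<^sub>L 'b bidual)"
  where "biadjoint G = adjoint_op (adjoint_op G)"

(* The weak-star topology of a dual space is the topology of pointwise convergence of
   functionals, which is the strong operator topology on operators into the reals. *)
abbreviation weak_star_topology :: "('a::real_normed_vector) dual topology"
  where "weak_star_topology \<equiv> strong_operator_topology"

(* For an infinite-dimensional range, dim returns the default value 0, so the condition
   dim = 1 is satisfied only by genuinely one-dimensional ranges. *)
definition rank_one :: "('a::real_normed_vector \<Rightarrow>\<^sub>L 'b::real_normed_vector) \<Rightarrow> bool"
  where "rank_one T \<longleftrightarrow> dim (range (blinfun_apply T)) = 1"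

definition daugavet_center :: "('a::real_normed_vector \<Rightarrow>\<^sub>L 'b::real_normed_vector) \<Rightarrow> bool"
  where "daugavet_center G \<longleftrightarrow> (\<forall>T. rank_one T \<longrightarrow> norm (G + T) = norm G + norm T)"

(* Cardinals are well-order relations up to order isomorphism, hence a relation: the cardinal
   k is the least cardinality of a subset of S that is dense in S. *)
definition has_density_character :: "'a::topological_space set \<Rightarrow> 'k rel \<Rightarrow> bool"
  where "has_density_character S k \<longleftrightarrow>
    (\<exists>D. D \<subseteq> S \<and> S \<subseteq> closure D \<and> |D| =o k) \<and>
    (\<forall>D. D \<subseteq> S \<and> S \<subseteq> closure D \<longrightarrow> k \<le>o |D| )"

definition omega_1 :: "nat set rel"
  where "omega_1 = cardSuc natLeq"

end

theory Submission
  imports Defs "HOL-Library.Countable_Set_Type"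
begin

text \<open>
  Testing the Daugavet equation on rank-one operators yields, for \<open>h \<in> X\<^sup>*\<close> and \<open>s \<in> Y\<close>, points \<open>x\<close> of
  the unit ball with \<open>h x\<close> almost equal to the norm of \<open>h\<close> and with \<open>norm (s + a G x)\<close> almost
  equal to \<open>norm s + a\<close>. Convex combinations of such points come weak-star close to any \<open>u\<close> in the
  unit ball of \<open>X\<^sup>*\<^sup>*\<close>. A sequence of them that approximates \<open>u\<close> on a given countable set \<open>A\<close> of
  functionals has a cluster point \<open>w\<close> that agrees with \<open>u\<close> on \<open>A\<close>, while some \<open>f\<close> in the
  unit ball of \<open>Y\<^sup>*\<close> satisfies \<open>w (f \<circ> G) = 1\<close> and almost norms a prescribed vector \<open>y\<close>. Since \<open>f \<circ> G\<close>
  can be added to \<open>A\<close>, a recursion of length \<open>\<omega>\<^sub>1\<close>, all of whose proper initial segments are countable,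
  deals with all vectors \<open>y\<close> of a dense set and all error bounds \<open>1 / (n + 1)\<close>.
\<close>

subsection \<open>The Hahn-Banach and Banach-Alaoglu theorems\<close>

definition sublinear :: "('a::real_vector \<Rightarrow> real) \<Rightarrow> bool"
  where "sublinear q \<longleftrightarrow>
    (\<forall>x y. q (x + y) \<le> q x + q y) \<and> (\<forall>c x. 0 \<le> c \<longrightarrow> q (c *\<^sub>R x) = c * q x)"

lemma sublinear_add: "sublinear q \<Longrightarrow> q (x + y) \<le> q x + q y"
  and sublinear_scaleR: "sublinear q \<Longrightarrow> 0 \<le> c \<Longrightarrow> q (c *\<^sub>R x) = c * q x"
  by (auto simp: sublinear_def)

lemma sublinear_zero: "sublinear q \<Longrightarrow> q 0 = 0"
  using sublinear_scaleR[of q 0 0] by simp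

lemma sublinear_minus: "sublinear q \<Longrightarrow> - q (- x) \<le> q x"
  using sublinear_add[of q x "- x"] sublinear_zero[of q] by simp

text \<open>One inequality for positive scalars suffices: applied to \<open>inverse c\<close> and
  \<open>c *\<^sub>R x\<close> it gives the reverse one.\<close>

lemma sublinearI:
  assumes add: "\<And>x y. q (x + y) \<le> q x + q y"
    and zero: "q 0 = 0"
    and scale: "\<And>c x. 0 < c \<Longrightarrow> q (c *\<^sub>R x) \<le> c * q x"
  shows "sublinear q"
  unfolding sublinear_def
proof (intro conjI allI impI add)
  fix c :: real and x assume "0 \<le> c"
  show "q (c *\<^sub>R x) = c * q x"
  proof (cases "c = 0")
    case False
    with \<open>0 \<le> c\<close> have c: "0 < c" by simp
    have "q x \<le> inverse c * q (c *\<^sub>R x)"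
      using scale[of "inverse c" "c *\<^sub>R x"] c by simp
    then have "c * q x \<le> q (c *\<^sub>R x)"
      using c by (simp add: field_simps)
    with scale[OF c, of x] show ?thesis by simp
  qed (simp add: zero)
qed

text \<open>For a minimal sublinear \<open>q\<close> this gives \<open>q (- x) \<le> - q x\<close>, whence \<open>q\<close> is linear.\<close>

lemma sublinear_tilt:
  assumes q: "sublinear q"
  obtains q' where "sublinear q'" "q' \<le> q" "q' (- x) \<le> - q x"
proof
  \<comment> \<open>The infimum over \<open>t\<close> makes \<open>q'\<close> as small as
    subadditivity permits once the value at \<open>- x\<close> is pushed down to
    \<open>- q x\<close>. Taking \<open>t = 0\<close> gives \<open>q' \<le> q\<close>, and
    \<open>t = 1\<close> gives the bound at \<open>- x\<close>. The infimum is finite because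
    \<open>q (t *\<^sub>R x) \<le> q (z + t *\<^sub>R x) + q (- z)\<close>.\<close>
  define Q where "Q = (\<lambda>z t. q (z + t *\<^sub>R x) - t * q x)"
  define q' where "q' = (\<lambda>z. INF t\<in>{0..}. Q z t)"
  have "- q (- z) \<le> Q z t" if "0 \<le> t" for z t
    using sublinear_add[OF q, of "z + t *\<^sub>R x" "- z"] sublinear_scaleR[OF q that, of x]
    by (simp add: Q_def)
  then have bdd: "bdd_below (Q z ` {0..})" for z
    by (auto intro!: bdd_belowI[of _ "- q (- z)"])
  have le: "q' z \<le> Q z t" if "0 \<le> t" for z t
    unfolding q'_def using bdd that by (intro cINF_lower) auto
  have ge: "c \<le> q' z" if "\<And>t. 0 \<le> t \<Longrightarrow> c \<le> Q z t" for c z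
    unfolding q'_def using that by (intro cINF_greatest) auto
  have Q_add: "Q (y + z) (s + t) \<le> Q y s + Q z t" for y z s t
    using sublinear_add[OF q, of "y + s *\<^sub>R x" "z + t *\<^sub>R x"]
    by (simp add: Q_def algebra_simps)
  show "sublinear q'"
  proof (rule sublinearI)
    fix y z
    have "q' (y + z) - Q z t \<le> q' y" if t: "0 \<le> t" for t
    proof (rule ge)
      fix s :: real assume "0 \<le> s"
      then show "q' (y + z) - Q z t \<le> Q y s"
        using le[of "s + t" "y + z"] Q_add[of y z s t] t by simp
    qed
    then have "q' (y + z) - q' y \<le> q' z"
      by (intro ge) (simp add: algebra_simps)
    then show "q' (y + z) \<le> q' y + q' z" by simp
  next
    have "Q 0 t = 0" if "0 \<le> t" for t
      by (simp add: Q_def sublinear_scaleR[OF q that])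
    then have "q' 0 \<le> 0" "0 \<le> q' 0"
      using le[of 0 0] ge[of 0 0] by auto
    then show "q' 0 = 0" by simp
  next
    fix c :: real and z assume c: "0 < c"
    have "q' (c *\<^sub>R z) / c \<le> q' z"
    proof (rule ge)
      fix t :: real assume t: "0 \<le> t"
      have "Q (c *\<^sub>R z) (c * t) = c * Q z t"
        using sublinear_scaleR[OF q, of c "z + t *\<^sub>R x"] c
        by (simp add: Q_def algebra_simps)
      then show "q' (c *\<^sub>R z) / c \<le> Q z t"
        using le[of "c * t" "c *\<^sub>R z"] c t by (simp add: field_simps)
    qed
    then show "q' (c *\<^sub>R z) \<le> c * q' z"
      using c by (simp add: field_simps)
  qed
  show "q' \<le> q"
    using le[of 0] by (auto simp: le_fun_def Q_def)
  show "q' (- x) \<le> - q x"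
    using le[of 1 "- x"] sublinear_zero[OF q] by (simp add: Q_def)
qed

text \<open>The pointwise infimum works. It is finite since every member is at least
  \<open>- q (- x)\<close> at \<open>x\<close>, and it is subadditive since of two members the
  smaller one bounds both terms.\<close>

lemma sublinear_chain_lower_bound:
  assumes C: "C \<noteq> {}" "\<And>p. p \<in> C \<Longrightarrow> sublinear p \<and> p \<le> q"
    and chain: "\<And>p p'. p \<in> C \<Longrightarrow> p' \<in> C \<Longrightarrow> p \<le> p' \<or> p' \<le> p"
  obtains l where "sublinear l" "\<And>p. p \<in> C \<Longrightarrow> l \<le> p"
proof
  define l where "l = (\<lambda>x. INF p\<in>C. p x)"
  have "- q (- x) \<le> p x" if "p \<in> C" for p x
    using sublinear_minus[of p x] C(2)[OF that] by (smt (verit) le_fun_def)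
  then have bdd: "bdd_below ((\<lambda>p. p x) ` C)" for x
    by (auto intro!: bdd_belowI[of _ "- q (- x)"])
  have le: "l x \<le> p x" if "p \<in> C" for p x
    unfolding l_def using bdd that by (intro cINF_lower) auto
  have ge: "c \<le> l x" if "\<And>p. p \<in> C \<Longrightarrow> c \<le> p x" for c x
    unfolding l_def using that C(1) by (intro cINF_greatest) auto
  show "l \<le> p" if "p \<in> C" for p
    using le[OF that] by (simp add: le_fun_def)
  show "sublinear l"
  proof (rule sublinearI)
    fix x y
    have *: "l (x + y) \<le> p x + p' y" if p: "p \<in> C" "p' \<in> C" for p p'
    proof -
      obtain r where r: "r \<in> C" "r \<le> p" "r \<le> p'"
        using chain[OF p] p by blast
      have "l (x + y) \<le> r (x + y)" by (rule le[OF r(1)])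
      also have "\<dots> \<le> r x + r y" using C(2)[OF r(1)] sublinear_add by blast
      also have "\<dots> \<le> p x + p' y" using r by (intro add_mono) (auto simp: le_fun_def)
      finally show ?thesis .
    qed
    have "l (x + y) - p' y \<le> l x" if "p' \<in> C" for p'
      using * that by (intro ge) (simp add: algebra_simps)
    then have "l (x + y) - l x \<le> l y"
      by (intro ge) (simp add: algebra_simps)
    then show "l (x + y) \<le> l x + l y" by simp
  next
    obtain p where "p \<in> C" using C(1) by blast
    have zero: "p 0 = 0" if "p \<in> C" for p
      using C(2)[OF that] sublinear_zero by blast
    have "0 \<le> l 0" by (rule ge) (simp add: zero)
    then show "l 0 = 0"
      using le[OF \<open>p \<in> C\<close>, of 0] zero[OF \<open>p \<in> C\<close>] by simp
  next
    fix c :: real and x assume c: "0 < c"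
    have "l (c *\<^sub>R x) / c \<le> l x"
    proof (rule ge)
      fix p assume p: "p \<in> C"
      then show "l (c *\<^sub>R x) / c \<le> p x"
        using le[OF p, of "c *\<^sub>R x"] sublinear_scaleR[of p c x] C(2)[OF p] c
        by (simp add: field_simps)
    qed
    then show "l (c *\<^sub>R x) \<le> c * l x"
      using c by (simp add: field_simps)
  qed
qed

text \<open>Zorn's lemma gives a minimal sublinear functional below \<open>q\<close>. Tilting cannot
  lower it further, so it is odd, and an odd sublinear functional is linear.\<close>

lemma Hahn_Banach_sublinear:
  assumes q: "sublinear q"
  obtains l where "linear l" "l \<le> q"
proof -
  let ?S = "{p. sublinear p \<and> p \<le> q}"
  \<comment> \<open>The order is reversed because \<open>predicate_Zorn\<close> produces maximal
    elements.\<close>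
  let ?P = "\<lambda>p p' :: 'a \<Rightarrow> real. p' \<le> p"
  have "\<exists>m\<in>?S. \<forall>a\<in>?S. a \<le> m \<longrightarrow> a = m"
  proof (rule predicate_Zorn[of ?S ?P])
    show "partial_order_on ?S (relation_of ?P ?S)"
      by (rule partial_order_on_relation_ofI) auto
  next
    fix C assume "C \<in> Chains (relation_of ?P ?S)"
    then have C: "\<And>p. p \<in> C \<Longrightarrow> sublinear p \<and> p \<le> q"
      and chain: "\<And>p p'. p \<in> C \<Longrightarrow> p' \<in> C \<Longrightarrow> p \<le> p' \<or> p' \<le> p"
      by (auto simp: Chains_def relation_of_def)
    show "\<exists>u\<in>?S. \<forall>a\<in>C. u \<le> a"
    proof (cases "C = {}")
      case True
      with q show ?thesis by auto
    next
      case False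
      then obtain l where "sublinear l" "\<And>p. p \<in> C \<Longrightarrow> l \<le> p"
        using sublinear_chain_lower_bound[OF False C chain] by blast
      with False C show ?thesis
        by (metis (mono_tags, lifting) mem_Collect_eq order_trans ex_in_conv)
    qed
  qed
  then obtain m where m: "sublinear m" "m \<le> q"
    and min: "\<And>a. sublinear a \<Longrightarrow> a \<le> m \<Longrightarrow> a = m"
    by (smt (verit, best) mem_Collect_eq order_trans)
  have neg: "m (- x) = - m x" for x
  proof -
    obtain q' where q': "sublinear q'" "q' \<le> m" "q' (- x) \<le> - m x"
      using sublinear_tilt[OF m(1)] by blast
    then have "m (- x) \<le> - m x" using min by blast
    then show ?thesis using sublinear_minus[OF m(1), of x] by simp
  qed
  have "linear m"
  proof (rule linearI)
    fix x y
    have "m x + m y \<le> m (x + y)"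
      using sublinear_add[OF m(1), of "- x" "- y"] neg[of x] neg[of y] neg[of "x + y"] by simp
    then show "m (x + y) = m x + m y"
      using sublinear_add[OF m(1), of x y] by simp
  next
    fix c x
    show "m (c *\<^sub>R x) = c *\<^sub>R m x"
    proof (cases "0 \<le> c")
      case False
      then have "m ((- c) *\<^sub>R x) = (- c) * m x"
        by (intro sublinear_scaleR[OF m(1)]) auto
      then show ?thesis using neg[of "c *\<^sub>R x"] by simp
    qed (simp add: sublinear_scaleR[OF m(1)])
  qed
  with m(2) that show thesis by blast
qed

text \<open>Tilting the norm at \<open>x\<close> before passing to a linear minorant
  \<open>l\<close> forces \<open>l (- x) \<le> - norm x\<close>, which replaces an extension from
  the span of \<open>x\<close>. The bound \<open>norm f \<le> 1\<close> also covers the zero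
  space.\<close>

lemma norming_functional:
  fixes x :: "'a::real_normed_vector"
  obtains f :: "'a dual" where "norm f \<le> 1" "blinfun_apply f x = norm x"
proof -
  have "sublinear (norm :: 'a \<Rightarrow> real)"
    by (auto simp: sublinear_def norm_triangle_ineq)
  then obtain q where q: "sublinear q" "q \<le> norm" "q (- x) \<le> - norm x"
    using sublinear_tilt by blast
  obtain l where l: "linear l" "l \<le> q"
    using Hahn_Banach_sublinear[OF q(1)] by blast
  have le: "l z \<le> norm z" for z
    using l(2) q(2) by (meson le_fun_def order_trans)
  have abs: "\<bar>l z\<bar> \<le> norm z" for z
    using le[of z] le[of "- z"] linear_neg[OF l(1), of z] by auto
  have bl: "bounded_linear l"
    using abs by (intro bounded_linear_intro[where K = 1])
      (simp_all add: linear_add[OF l(1)] linear_scale[OF l(1)])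
  have "l (- x) \<le> - norm x"
    using l(2) q(3) by (meson le_fun_def order_trans)
  then have "l x = norm x"
    using le[of x] linear_neg[OF l(1), of x] by simp
  moreover have "norm (Blinfun l) \<le> 1"
    by (rule norm_blinfun_bound) (use abs bl in \<open>auto simp: bounded_linear_Blinfun_apply\<close>)
  ultimately show thesis
    using that[of "Blinfun l"] by (simp add: bounded_linear_Blinfun_apply[OF bl])
qed

section \<open>Weak-star compactness of the dual unit ball\<close>

lemma dual_ball_apply_le:
  assumes "norm (f :: 'a::real_normed_vector dual) \<le> 1"
  shows "blinfun_apply f x \<le> norm x"
  using norm_blinfun[of f x] assms mult_right_mono[OF assms, of "norm x"] by simp

text \<open>Weak-star compactness in the form of the finite intersection property, for conditions
  that each confine the value at one point to a closed set.\<close>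

lemma Banach_Alaoglu_fip:
  fixes x :: "'i \<Rightarrow> 'a::real_normed_vector" and C :: "'i \<Rightarrow> real set"
  assumes closed: "\<And>i. i \<in> I \<Longrightarrow> closed (C i)"
    and fin: "\<And>F. finite F \<Longrightarrow> F \<subseteq> I \<Longrightarrow>
      \<exists>f \<in> cball (0 :: 'a dual) 1. \<forall>i\<in>F. blinfun_apply f (x i) \<in> C i"
  shows "\<exists>f \<in> cball (0 :: 'a dual) 1. \<forall>i\<in>I. blinfun_apply f (x i) \<in> C i"
proof -
  \<comment> \<open>\<open>?K\<close> is compact by Tychonoff's theorem and \<open>?L\<close> is the
    closed set of linear functions; their intersection is the dual unit ball, seen inside the
    product space.\<close>
  let ?K = "(\<Pi>\<^sub>E z\<in>UNIV. cball 0 (norm z)) :: ('a \<Rightarrow> real) set"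
  let ?L = "\<Inter>y. \<Inter>z. \<Inter>c. {h :: 'a \<Rightarrow> real. h (c *\<^sub>R y + z) - (c * h y + h z) = 0}"
  have "compactin (product_topology (\<lambda>_ :: 'a. euclideanreal) UNIV) ?K"
    by (subst compactin_PiE) (auto simp: compactin_euclidean_iff)
  then have "compact ?K"
    by (simp add: euclidean_product_topology compactin_euclidean_iff)
  moreover have "closed ?L"
    by (intro closed_INT ballI closed_Collect_eq continuous_intros
        continuous_on_product_coordinates)
  ultimately have "compact (?K \<inter> ?L)"
    by (rule compact_Int_closed)
  moreover have "closed {h :: 'a \<Rightarrow> real. h (x i) \<in> C i}" if "i \<in> I" for i
    using closed_vimage[OF closed[OF that], of "\<lambda>h :: 'a \<Rightarrow> real. h (x i)"]
    by (simp add: vimage_def)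
  moreover have "?K \<inter> ?L \<inter> (\<Inter>i\<in>F. {h. h (x i) \<in> C i}) \<noteq> {}" if F: "finite F" "F \<subseteq> I" for F
  proof -
    obtain f :: "'a dual" where f: "norm f \<le> 1" "\<forall>i\<in>F. blinfun_apply f (x i) \<in> C i"
      using fin[OF F] by auto
    have "\<bar>blinfun_apply f z\<bar> \<le> norm z" for z
      using dual_ball_apply_le[OF f(1), of z] dual_ball_apply_le[OF f(1), of "- z"]
      by (simp add: blinfun.minus_right abs_le_iff)
    then have "blinfun_apply f \<in> ?K \<inter> ?L \<inter> (\<Inter>i\<in>F. {h. h (x i) \<in> C i})"
      using f(2) by (auto simp: blinfun.add_right blinfun.scaleR_right)
    then show ?thesis by blast
  qed
  ultimately have "?K \<inter> ?L \<inter> (\<Inter>i\<in>I. {h. h (x i) \<in> C i}) \<noteq> {}"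
    by (rule compact_imp_fip_image)
  then obtain h where "h \<in> ?K \<inter> ?L \<inter> (\<Inter>i\<in>I. {h. h (x i) \<in> C i})" by blast
  then have h: "\<bar>h z\<bar> \<le> norm z" "h (c *\<^sub>R y + z) = c * h y + h z"
      "i \<in> I \<Longrightarrow> h (x i) \<in> C i" for c y z i
    by (auto simp: PiE_iff)
  have "h 0 = 0" using h(1)[of 0] by simp
  have bl: "bounded_linear h"
  proof (rule bounded_linear_intro[where K = 1])
    show "h (y + z) = h y + h z" for y z using h(2)[of 1 y z] by simp
    show "h (c *\<^sub>R y) = c *\<^sub>R h y" for c y using h(2)[of c y 0] \<open>h 0 = 0\<close> by simp
  qed (use h(1) in auto)
  show ?thesis
  proof (intro bexI[of _ "Blinfun h"] ballI)
    show "Blinfun h \<in> cball 0 1"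
      using norm_blinfun_bound[of 1 "Blinfun h"] h(1) by (simp add: bounded_linear_Blinfun_apply[OF bl])
  qed (use h(3) in \<open>auto simp: bounded_linear_Blinfun_apply[OF bl]\<close>)
qed

subsection \<open>Daugavet centers and weak neighbourhoods\<close>

lemma blinfun_norm_approx:
  fixes T :: "'a::real_normed_vector \<Rightarrow>\<^sub>L 'b::real_normed_vector"
  assumes "c < norm T"
  obtains x where "norm x \<le> 1" "c < norm (blinfun_apply T x)"
proof (cases "0 \<le> c")
  case True
  then have "\<not> (\<forall>x. norm (blinfun_apply T x) \<le> c * norm x)"
    using norm_blinfun_bound[of c T] assms by (auto simp: not_less[symmetric])
  then obtain x where x: "c * norm x < norm (blinfun_apply T x)"
    by (auto simp: not_le)
  then have "x \<noteq> 0" by auto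
  then have "c < norm (blinfun_apply T (x /\<^sub>R norm x))"
    using x by (simp add: blinfun.scaleR_right field_simps)
  with that[of "x /\<^sub>R norm x"] \<open>x \<noteq> 0\<close> show thesis by simp
next
  case False
  then show thesis using that[of 0] by simp
qed

lemma norm_blinfun_le: "norm T \<le> 1 \<Longrightarrow> norm x \<le> 1 \<Longrightarrow> norm (blinfun_apply T x) \<le> 1"
  by (meson mult_le_one norm_blinfun norm_ge_zero order_trans)

text \<open>The operator \<open>T\<close> sending \<open>x\<close> to \<open>f x\<close> times
  \<open>p\<close> has rank one and norm 1, so \<open>norm (G + T) = 2\<close>. A point where this
  norm is almost attained must have \<open>f x\<close> close to 1 up to sign, and then
  \<open>p\<close> may replace \<open>f x\<close> times \<open>p\<close>.\<close>

lemma daugavet_center_slice_normalized: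
  fixes G :: "'a::real_normed_vector \<Rightarrow>\<^sub>L 'b::real_normed_vector"
  assumes G: "daugavet_center G" "norm G = 1"
    and f: "norm f = 1" and p: "norm p = 1" and d: "0 < d"
  obtains x where "norm x \<le> 1" "1 - d \<le> blinfun_apply f x"
    "2 - d \<le> norm (p + blinfun_apply G x)"
proof -
  define T where "T = blinfun_scaleR_left p o\<^sub>L f"
  have T: "blinfun_apply T x = blinfun_apply f x *\<^sub>R p" for x
    by (simp add: T_def)
  have "norm T = 1"
  proof (rule antisym)
    show "norm T \<le> 1"
      using norm_blinfun[of f] f p by (intro norm_blinfun_bound) (auto simp: T)
    have "norm f \<le> norm T"
      using norm_blinfun[of T] p by (intro norm_blinfun_bound) (auto simp: T)
    with f show "1 \<le> norm T" by simp
  qed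
  have "f \<noteq> 0" using f by auto
  then obtain z where z: "blinfun_apply f z \<noteq> 0"
    by (metis blinfun_eqI zero_blinfun.rep_eq)
  have "range (blinfun_apply T) = span {p}"
  proof -
    have "c *\<^sub>R p \<in> range (blinfun_apply T)" for c
      using z by (intro range_eqI[of _ _ "(c / blinfun_apply f z) *\<^sub>R z"])
        (simp add: T blinfun.scaleR_right)
    then show ?thesis by (auto simp: span_singleton T)
  qed
  moreover have "independent {p}" using p by auto
  ultimately have "rank_one T"
    using dim_eq_card_independent[of "{p}"] by (simp add: rank_one_def)
  then have "norm (G + T) = 2"
    using G \<open>norm T = 1\<close> by (simp add: daugavet_center_def)
  \<comment> \<open>One half of \<open>d\<close> is used up here, the other when
    \<open>t *\<^sub>R p\<close> is replaced by \<open>p\<close>, which costs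
    \<open>1 - t \<le> d / 2\<close>.\<close>
  then obtain w where w: "norm w \<le> 1" "2 - d / 2 < norm (blinfun_apply (G + T) w)"
    using blinfun_norm_approx[of "2 - d / 2" "G + T"] d by auto
  define x where "x = (if 0 \<le> blinfun_apply f w then w else - w)"
  define t where "t = blinfun_apply f x"
  have x: "norm x \<le> 1" "0 \<le> t"
    using w by (auto simp: x_def t_def blinfun.minus_right)
  have "norm (blinfun_apply (G + T) x) = norm (blinfun_apply (G + T) w)"
    by (simp add: x_def blinfun.minus_right)
  then have *: "2 - d / 2 < norm (blinfun_apply G x + t *\<^sub>R p)"
    using w by (simp add: T t_def plus_blinfun.rep_eq)
  have Gx: "norm (blinfun_apply G x) \<le> 1"
    using norm_blinfun_le[of G x] x G by simp
  have t1: "t \<le> 1"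
    using norm_blinfun_le[of f x] x f by (simp add: t_def)
  have "norm (blinfun_apply G x + t *\<^sub>R p) \<le> 1 + t"
    using norm_triangle_ineq[of "blinfun_apply G x" "t *\<^sub>R p"] Gx p x by simp
  then have t: "1 - d / 2 \<le> t" using * by simp
  have "norm (blinfun_apply G x + t *\<^sub>R p) = norm ((p + blinfun_apply G x) - (1 - t) *\<^sub>R p)"
    by (simp add: algebra_simps)
  also have "\<dots> \<le> norm (p + blinfun_apply G x) + (1 - t)"
    using norm_triangle_ineq4[of "p + blinfun_apply G x" "(1 - t) *\<^sub>R p"] p t1 by simp
  finally have "norm (blinfun_apply G x + t *\<^sub>R p) \<le> norm (p + blinfun_apply G x) + (1 - t)" .
  with * t have "2 - d \<le> norm (p + blinfun_apply G x)" by simp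
  moreover have "1 - d \<le> blinfun_apply f x" using t d by (simp add: t_def)
  ultimately show thesis using that x by blast
qed

text \<open>By symmetry let \<open>a \<le> b\<close>. In \<open>b *\<^sub>R (p + q) = (b *\<^sub>R p
  + a *\<^sub>R q) + (b - a) *\<^sub>R q\<close> the triangle inequality loses only
  \<open>b * d\<close>.\<close>

lemma norm_add_scaled_ge:
  fixes p q :: "'a::real_normed_vector"
  assumes "norm p \<le> 1" "norm q \<le> 1" "2 - d \<le> norm (p + q)" "0 \<le> b" "0 \<le> a" "0 \<le> d"
  shows "(b + a) - (b + a) * d \<le> norm (b *\<^sub>R p + a *\<^sub>R q)"
proof -
  have *: "(b + a) - (b + a) * d \<le> norm (b *\<^sub>R p + a *\<^sub>R q)"
    if "norm p \<le> 1" "norm q \<le> 1" "2 - d \<le> norm (p + q)" "0 \<le> a" "a \<le> b"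
    for p q :: 'a and a b
  proof -
    have "b *\<^sub>R (p + q) = (b *\<^sub>R p + a *\<^sub>R q) + (b - a) *\<^sub>R q"
      by (simp add: algebra_simps)
    then have "b * norm (p + q) \<le> norm (b *\<^sub>R p + a *\<^sub>R q) + (b - a) * norm q"
      using norm_triangle_ineq[of "b *\<^sub>R p + a *\<^sub>R q" "(b - a) *\<^sub>R q"]
        norm_scaleR[of b "p + q"] that by simp
    moreover have "b * (2 - d) \<le> b * norm (p + q)" "(b - a) * norm q \<le> b - a"
      using that by (auto intro: mult_left_mono mult_left_le)
    moreover have "0 \<le> a * d" using that assms by simp
    ultimately show ?thesis by (simp add: algebra_simps)
  qed
  show ?thesis
    using *[of p q a b] *[of q p b a] assms
    by (cases "a \<le> b") (auto simp: add.commute)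
qed

text \<open>The normalized case is rescaled to arbitrary \<open>f\<close> and \<open>s\<close> and
  to a weight \<open>a\<close> on \<open>G x\<close>.\<close>

lemma daugavet_center_slice:
  fixes G :: "'a::real_normed_vector \<Rightarrow>\<^sub>L 'b::real_normed_vector"
  assumes G: "daugavet_center G" "norm G = 1" and a: "0 \<le> a" and d: "0 < d"
  obtains x where "norm x \<le> 1" "norm f - d \<le> blinfun_apply f x"
    "norm s + a - d \<le> norm (s + a *\<^sub>R blinfun_apply G x)"
proof -
  obtain x0 where x0: "blinfun_apply G x0 \<noteq> 0"
    using G(2) by (metis blinfun_eqI norm_zero zero_blinfun.rep_eq zero_neq_one)
  \<comment> \<open>A zero functional or zero vector is replaced by some unit vector, so that
    \<open>norm f *\<^sub>R f0 = f\<close> and \<open>norm s *\<^sub>R p = s\<close> hold in every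
    case.\<close>
  define f0 where "f0 = (if f = 0 then SOME f. norm f = 1 else f /\<^sub>R norm f)"
  define p where "p = (if s = 0 then blinfun_apply G x0 /\<^sub>R norm (blinfun_apply G x0) else s /\<^sub>R norm s)"
  have p: "norm p = 1" "norm s *\<^sub>R p = s" using x0 by (auto simp: p_def)
  have "\<exists>f :: 'a dual. norm f = 1"
  proof -
    obtain f :: "'a dual" where "blinfun_apply f x0 = norm x0"
      using norming_functional by blast
    then have "f \<noteq> 0" using x0 by auto
    then show ?thesis by (intro exI[of _ "f /\<^sub>R norm f"]) simp
  qed
  then have f0: "norm f0 = 1" "norm f *\<^sub>R f0 = f"
    by (auto simp: f0_def intro: someI_ex)
  \<comment> \<open>Both \<open>norm f * e\<close> and \<open>(norm s + a) * e\<close> are then at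
    most \<open>d\<close>; the summand 1 keeps the denominator positive.\<close>
  define e where "e = d / (norm f + norm s + a + 1)"
  have pos: "0 < norm f + norm s + a + 1"
    using a by (simp add: add_nonneg_pos)
  then have e: "0 < e" using d by (simp add: e_def)
  have ed: "k * e \<le> d" if "k \<le> norm f + norm s + a + 1" for k
  proof -
    have "k * e \<le> (norm f + norm s + a + 1) * e" using that e by (intro mult_right_mono) auto
    also have "\<dots> = d" using pos by (simp add: e_def)
    finally show ?thesis .
  qed
  obtain x where x: "norm x \<le> 1" "1 - e \<le> blinfun_apply f0 x"
      "2 - e \<le> norm (p + blinfun_apply G x)"
    using daugavet_center_slice_normalized[OF G f0(1) p(1) e] by blast
  have "norm f * (1 - e) \<le> norm f * blinfun_apply f0 x"
    using x by (intro mult_left_mono) auto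
  also have "\<dots> = blinfun_apply f x"
    using arg_cong[OF f0(2), of "\<lambda>f. blinfun_apply f x"] by (simp add: scaleR_blinfun.rep_eq)
  finally have "norm f - d \<le> blinfun_apply f x"
    using ed[of "norm f"] a by (simp add: algebra_simps)
  moreover have "norm (blinfun_apply G x) \<le> 1"
    using norm_blinfun_le[of G x] x G by simp
  then have "norm s + a - (norm s + a) * e \<le> norm (s + a *\<^sub>R blinfun_apply G x)"
    using norm_add_scaled_ge[of p "blinfun_apply G x" e "norm s" a] p x a e by simp
  then have "norm s + a - d \<le> norm (s + a *\<^sub>R blinfun_apply G x)"
    using ed[of "norm s + a"] by simp
  ultimately show thesis using that x by blast
qed

text \<open>
  A Frank-Wolfe argument: the convex combinations below remain almost \<open>\<ell>\<^sub>1\<close>-orthogonal to \<open>s\<close>,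
  and moving towards an almost maximiser of \<open>\<Sum>h\<in>H. (u h - h x) h\<close> decreases
  the squared distance \<open>\<Sum>h\<in>H. (u h - h x)\<^sup>2\<close> by a definite amount.
\<close>

lemma daugavet_center_weak_neighbourhood:
  fixes G :: "'a::real_normed_vector \<Rightarrow>\<^sub>L 'b::real_normed_vector" and u :: "'a bidual"
  assumes G: "daugavet_center G" "norm G = 1" and u: "norm u \<le> 1"
    and H: "finite H" and a: "0 \<le> a" and d: "0 < d"
  obtains x where "norm x \<le> 1" "norm s + a - d \<le> norm (s + a *\<^sub>R blinfun_apply G x)"
    "\<And>h. h \<in> H \<Longrightarrow> \<bar>blinfun_apply h x - blinfun_apply u h\<bar> \<le> d"
proof -
  define good where "good = (\<lambda>s a d x. norm x \<le> 1 \<and>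
    norm s + a - d \<le> norm (s + a *\<^sub>R blinfun_apply G x))"
  define D where "D = (\<lambda>x. \<Sum>h\<in>H. (blinfun_apply u h - blinfun_apply h x)\<^sup>2)"
  \<comment> \<open>A level \<open>c\<close> must be reachable for all weights \<open>a\<close> and
    errors \<open>d\<close> at once, because the improvement below starts from a point with weight
    \<open>a * (1 - t)\<close> and error \<open>d / 2\<close>.\<close>
  define A where "A = {c. \<forall>s a d. 0 \<le> a \<longrightarrow> 0 < d \<longrightarrow> (\<exists>x. good s a d x \<and> D x \<le> c)}"
  define K where "K = (\<Sum>h\<in>H. (2 * norm h)\<^sup>2) + 1"
  have K: "0 < K" by (simp add: K_def sum_nonneg add_nonneg_pos)
  have hx: "\<bar>blinfun_apply h x\<bar> \<le> norm h" if "norm x \<le> 1" for h :: "'a dual" and x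
    using norm_blinfun[of h x] mult_left_le[of "norm x" "norm h"] that by simp
  have uh: "\<bar>blinfun_apply u h\<bar> \<le> norm h" for h
    using norm_blinfun[of u h] mult_right_mono[OF u, of "norm h"] by simp
  have sq: "(r - r')\<^sup>2 \<le> (2 * norm h)\<^sup>2" if "\<bar>r\<bar> \<le> norm h" "\<bar>r'\<bar> \<le> norm h"
    for r r' and h :: "'a dual"
    using that by (intro abs_le_square_iff[THEN iffD1]) auto
  have DK: "D x \<le> K" if "norm x \<le> 1" for x
  proof -
    have "D x \<le> (\<Sum>h\<in>H. (2 * norm h)\<^sup>2)"
      unfolding D_def by (intro sum_mono sq uh hx that)
    then show ?thesis by (simp add: K_def)
  qed
  have D0: "0 \<le> D x" for x
    by (simp add: D_def sum_nonneg)
  have "K \<in> A"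
    unfolding A_def
  proof (intro CollectI allI impI)
    fix s :: 'b and a d :: real assume "0 \<le> a" "0 < d"
    then obtain x where "norm x \<le> 1" "norm s + a - d \<le> norm (s + a *\<^sub>R blinfun_apply G x)"
      by (rule daugavet_center_slice[OF G, of _ _ 0])
    then show "\<exists>x. good s a d x \<and> D x \<le> K"
      using DK by (auto simp: good_def)
  qed
  have A_ex: "\<exists>x. good s a d x \<and> D x \<le> c" if "c \<in> A" "0 \<le> a" "0 < d" for s a d c
    using that by (simp add: A_def)
  have A0: "0 \<le> c" if "c \<in> A" for c
    using A_ex[OF that order_refl zero_less_one] D0 order_trans by blast
  \<comment> \<open>A step of length \<open>t\<close> gives
    \<open>D z \<le> D x - 2 * t * (D x - e) + t\<^sup>2 * K\<close>, and
    \<open>e \<le> t * K\<close> turns the error into \<open>3 * K * t\<^sup>2\<close>. The bound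
    \<open>t \<le> 1 / 2\<close> keeps the factor of \<open>c\<close> nonnegative.\<close>
  have improve: "(1 - 2 * t) * c + 3 * K * t\<^sup>2 \<in> A"
    if c: "c \<in> A" and t: "0 < t" "t \<le> 1 / 2" for c t
    unfolding A_def
  proof (intro CollectI allI impI)
    fix s :: 'b and a d :: real
    assume a: "0 \<le> a" and d: "0 < d"
    obtain x where x: "good s (a * (1 - t)) (d / 2) x" "D x \<le> c"
      using A_ex[OF c, of "a * (1 - t)" "d / 2"] a d t by auto
    define s' where "s' = s + (a * (1 - t)) *\<^sub>R blinfun_apply G x"
    \<comment> \<open>This is minus half the gradient of the squared distance:
      \<open>u f - f x = D x\<close>. As \<open>u f \<le> norm f\<close>, a point \<open>x'\<close>
      almost norming \<open>f\<close> gains \<open>f x' - f x \<ge> D x - e\<close>.\<close>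
    define f where "f = (\<Sum>h\<in>H. (blinfun_apply u h - blinfun_apply h x) *\<^sub>R h)"
    define e where "e = min (d / 2) (t * K)"
    have e: "0 < e" "e \<le> d / 2" "e \<le> t * K" using d t K by (auto simp: e_def)
    obtain x' where x': "norm x' \<le> 1" "norm f - e \<le> blinfun_apply f x'"
        "norm s' + a * t - e \<le> norm (s' + (a * t) *\<^sub>R blinfun_apply G x')"
      using daugavet_center_slice[OF G, of "a * t" e f s'] a t e by auto
    define z where "z = (1 - t) *\<^sub>R x + t *\<^sub>R x'"
    have "norm z \<le> (1 - t) * norm x + t * norm x'"
      using norm_triangle_ineq[of "(1 - t) *\<^sub>R x" "t *\<^sub>R x'"] t by (simp add: z_def)
    also have "\<dots> \<le> (1 - t) * 1 + t * 1"
      using x x' t by (intro add_mono mult_left_mono) (auto simp: good_def)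
    finally have "norm z \<le> 1" by simp
    moreover have "s + a *\<^sub>R blinfun_apply G z = s' + (a * t) *\<^sub>R blinfun_apply G x'"
      unfolding s'_def z_def blinfun.add_right blinfun.scaleR_right by (simp add: algebra_simps)
    moreover have "norm s + a * (1 - t) - d / 2 \<le> norm s'"
      using x by (simp add: good_def s'_def)
    ultimately have "good s a d z"
      using x' e by (simp add: good_def algebra_simps)
    moreover have "D z \<le> (1 - 2 * t) * c + 3 * K * t\<^sup>2"
    proof -
      define q where "q = (\<lambda>h. blinfun_apply u h - blinfun_apply h x)"
      define r where "r = (\<lambda>h :: 'a dual. blinfun_apply h x' - blinfun_apply h x)"
      have "D z = (\<Sum>h\<in>H. (q h - t * r h)\<^sup>2)"
        unfolding D_def z_def q_def r_def blinfun.add_right blinfun.scaleR_right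
        by (simp add: algebra_simps)
      also have "\<dots> = (\<Sum>h\<in>H. (q h)\<^sup>2 - 2 * t * (q h * r h) + t\<^sup>2 * (r h)\<^sup>2)"
        by (simp add: power2_eq_square algebra_simps)
      also have "\<dots> = D x - 2 * t * (\<Sum>h\<in>H. q h * r h) + t\<^sup>2 * (\<Sum>h\<in>H. (r h)\<^sup>2)"
        by (simp add: D_def q_def sum.distrib sum_subtractf sum_distrib_left)
      finally have Dz: "D z = \<dots>" .
      have f_app: "blinfun_apply f y = (\<Sum>h\<in>H. q h * blinfun_apply h y)" for y
        by (simp add: f_def q_def blinfun.sum_left scaleR_blinfun.rep_eq)
      have "blinfun_apply u f = (\<Sum>h\<in>H. q h * blinfun_apply u h)"
        by (simp add: f_def q_def blinfun.sum_right blinfun.scaleR_right)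
      then have "blinfun_apply u f - blinfun_apply f x = D x"
        unfolding f_app D_def q_def by (simp add: power2_eq_square algebra_simps flip: sum_subtractf)
      moreover have "(\<Sum>h\<in>H. q h * r h) = blinfun_apply f x' - blinfun_apply f x"
        unfolding f_app r_def by (simp add: algebra_simps flip: sum_subtractf)
      moreover have "blinfun_apply u f \<le> norm f" using uh[of f] by simp
      ultimately have "D x - e \<le> (\<Sum>h\<in>H. q h * r h)" using x' by simp
      then have "2 * t * (D x - t * K) \<le> 2 * t * (\<Sum>h\<in>H. q h * r h)"
        using e t by (intro mult_left_mono) auto
      moreover have "(\<Sum>h\<in>H. (r h)\<^sup>2) \<le> K"
      proof -
        have "norm x \<le> 1" using x by (simp add: good_def)
        then have "(\<Sum>h\<in>H. (r h)\<^sup>2) \<le> (\<Sum>h\<in>H. (2 * norm h)\<^sup>2)"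
          unfolding r_def by (intro sum_mono sq hx x')
        then show ?thesis by (simp add: K_def)
      qed
      then have "t\<^sup>2 * (\<Sum>h\<in>H. (r h)\<^sup>2) \<le> t\<^sup>2 * K"
        by (intro mult_left_mono) auto
      moreover have "(1 - 2 * t) * D x \<le> (1 - 2 * t) * c"
        using x t by (intro mult_left_mono) auto
      ultimately show ?thesis
        unfolding Dz by (simp add: algebra_simps power2_eq_square)
    qed
    ultimately show "\<exists>x. good s a d x \<and> D x \<le> (1 - 2 * t) * c + 3 * K * t\<^sup>2" by blast
  qed
  define c0 where "c0 = Inf A"
  have bdd: "bdd_below A" using A0 by (rule bdd_belowI)
  have "c0 \<le> 0"
  proof (rule ccontr)
    assume "\<not> c0 \<le> 0"
    then have c0: "0 < c0" by simp
    \<comment> \<open>With this \<open>t\<close> the quadratic error is at most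
      \<open>t * c0 / 2\<close>, and so is the excess of \<open>c\<close> over \<open>c0\<close>,
      whereas the linear term gains about \<open>2 * t * c0\<close>; the new level would lie below
      the infimum.\<close>
    define t where "t = min (1 / 2) (c0 / (6 * K))"
    have t: "0 < t" "t \<le> 1 / 2" "t * (6 * K) \<le> c0"
      using c0 K by (auto simp: t_def field_simps min_def)
    obtain c where c: "c \<in> A" "c < c0 + t * c0 / 2"
      using cInf_lessD[of A "c0 + t * c0 / 2"] \<open>K \<in> A\<close> c0 t by (auto simp: c0_def)
    have "c0 \<le> (1 - 2 * t) * c + 3 * K * t\<^sup>2"
      using improve[OF c(1) t(1,2)] bdd unfolding c0_def by (rule cInf_lower)
    moreover have "(1 - 2 * t) * c \<le> (1 - 2 * t) * (c0 + t * c0 / 2)"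
      using c t by (intro mult_left_mono) auto
    moreover have "3 * K * t\<^sup>2 \<le> t * c0 / 2"
      using mult_left_mono[OF t(3), of t] t by (simp add: power2_eq_square algebra_simps)
    moreover have "(1 - 2 * t) * (c0 + t * c0 / 2) = c0 - 3 / 2 * (t * c0) - t * (t * c0)"
      by (simp add: field_simps)
    moreover have "0 < t * c0" "0 \<le> t * (t * c0)" using t c0 by auto
    ultimately show False by linarith
  qed
  moreover have "0 < d\<^sup>2" using d by simp
  ultimately have "Inf A < d\<^sup>2" unfolding c0_def by (rule le_less_trans)
  then obtain c where c: "c \<in> A" "c < d\<^sup>2"
    using cInf_lessD[of A "d\<^sup>2"] \<open>K \<in> A\<close> by blast
  then obtain x where x: "good s a d x" "D x \<le> c"
    using A_ex[OF _ a d] by blast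
  show thesis
  proof (rule that)
    fix h assume "h \<in> H"
    then have "(blinfun_apply u h - blinfun_apply h x)\<^sup>2 \<le> D x"
      unfolding D_def using H by (intro member_le_sum) auto
    then have "(blinfun_apply u h - blinfun_apply h x)\<^sup>2 \<le> d\<^sup>2"
      using x c by simp
    then show "\<bar>blinfun_apply h x - blinfun_apply u h\<bar> \<le> d"
      using abs_le_square_iff[of "blinfun_apply u h - blinfun_apply h x" d] d
      by (simp add: abs_minus_commute)
  qed (use x in \<open>auto simp: good_def\<close>)
qed

section \<open>Cluster points in the bidual and functionals norming a single vector\<close>

lemma norm_canonical_embedding_le: "norm (canonical_embedding y) \<le> norm y"
proof (rule norm_blinfun_bound)
  show "norm (blinfun_apply (canonical_embedding y) f) \<le> norm y * norm f" for f
    using norm_blinfun[of f y] by (simp add: canonical_embedding.rep_eq mult.commute)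
qed simp

text \<open>Finitely many of the conditions \<open>\<bar>w h - c\<bar> \<le> e\<close> are met by
  the canonical image of one late \<open>x n\<close>; compactness of the bidual ball then satisfies
  all of them, for every \<open>e > 0\<close>.\<close>

lemma bidual_cluster_point:
  fixes x :: "nat \<Rightarrow> 'a::real_normed_vector"
  assumes x: "\<And>n. norm (x n) \<le> 1"
  obtains w :: "'a bidual" where "norm w \<le> 1"
    "\<And>h c. (\<lambda>n. blinfun_apply h (x n)) \<longlonglongrightarrow> c \<Longrightarrow> blinfun_apply w h = c"
proof -
  let ?I = "{(h :: 'a dual, c, e). (\<lambda>n. blinfun_apply h (x n)) \<longlonglongrightarrow> c \<and> (0 :: real) < e}"
  have "\<exists>w \<in> cball (0 :: 'a bidual) 1. \<forall>i\<in>?I. blinfun_apply w (fst i) \<in> cball (fst (snd i)) (snd (snd i))"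
  proof (rule Banach_Alaoglu_fip)
    fix F :: "('a dual \<times> real \<times> real) set" assume F: "finite F" "F \<subseteq> ?I"
    have "\<forall>i\<in>F. \<forall>\<^sub>F n in sequentially. blinfun_apply (fst i) (x n) \<in> cball (fst (snd i)) (snd (snd i))"
    proof
      fix i assume "i \<in> F"
      then obtain h c e where i: "i = (h, c, e)" "(\<lambda>n. blinfun_apply h (x n)) \<longlonglongrightarrow> c" "0 < e"
        using F by auto
      show "\<forall>\<^sub>F n in sequentially. blinfun_apply (fst i) (x n) \<in> cball (fst (snd i)) (snd (snd i))"
        using tendstoD[OF i(2,3)] by eventually_elim (simp add: i(1) dist_commute less_imp_le)
    qed
    then have "\<forall>\<^sub>F n in sequentially. \<forall>i\<in>F. blinfun_apply (fst i) (x n) \<in> cball (fst (snd i)) (snd (snd i))"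
      using F(1) by (simp add: eventually_ball_finite_distrib)
    then obtain n where n: "\<forall>i\<in>F. blinfun_apply (fst i) (x n) \<in> cball (fst (snd i)) (snd (snd i))"
      by (rule eventually_happens'[OF sequentially_bot, THEN exE])
    show "\<exists>w \<in> cball (0 :: 'a bidual) 1. \<forall>i\<in>F. blinfun_apply w (fst i) \<in> cball (fst (snd i)) (snd (snd i))"
      using n order_trans[OF norm_canonical_embedding_le x[of n]]
      by (intro bexI[of _ "canonical_embedding (x n)"]) (auto simp: canonical_embedding.rep_eq)
  qed simp
  then obtain w :: "'a bidual" where w: "w \<in> cball 0 1"
      "\<forall>i\<in>?I. blinfun_apply w (fst i) \<in> cball (fst (snd i)) (snd (snd i))"
    by (rule bexE)
  show thesis
  proof (rule that)
    show "norm w \<le> 1" using w(1) by simp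
    fix h :: "'a dual" and c assume lim: "(\<lambda>n. blinfun_apply h (x n)) \<longlonglongrightarrow> c"
    have "dist c (blinfun_apply w h) \<le> e" if "0 < e" for e
      using bspec[OF w(2), of "(h, c, e)"] lim that by simp
    then have "dist c (blinfun_apply w h) \<le> 0"
      by (rule field_le_epsilon) simp
    then show "blinfun_apply w h = c" by simp
  qed
qed

text \<open>
  The points \<open>x n\<close> are chosen so that \<open>norm (y + (\<Sum>n<N. (n + 1) G (x n)))\<close> is, for all \<open>N\<close>,
  maximal up to \<open>e\<close>. A functional norming this vector is then \<open>\<ge> norm y - e\<close> at \<open>y\<close> and
  \<open>\<ge> 1 - e / (n + 1)\<close> at \<open>G (x n)\<close>; the weights \<open>n + 1\<close> thus make its values at \<open>G (x n)\<close>
  tend to \<open>1\<close>.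
\<close>

lemma daugavet_center_single_vector:
  fixes G :: "'a::real_normed_vector \<Rightarrow>\<^sub>L 'b::real_normed_vector" and u :: "'a bidual"
  assumes G: "daugavet_center G" "norm G = 1" and u: "norm u \<le> 1"
    and A: "countable A" and e: "0 < e"
  obtains f w where "norm f \<le> 1" "norm y - e \<le> blinfun_apply f y" "norm w \<le> 1"
    "\<And>h. h \<in> A \<Longrightarrow> blinfun_apply w h = blinfun_apply u h" "blinfun_apply w (f o\<^sub>L G) = 1"
proof -
  \<comment> \<open>These errors have sum at most \<open>e\<close>, which bounds the total loss of
    norm, and they tend to 0, which gives convergence to \<open>u\<close> on
    \<open>A\<close>.\<close>
  define d where "d = (\<lambda>n :: nat. e / 2 ^ Suc n)"
  have d: "0 < d n" for n using e by (simp add: d_def)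
  \<comment> \<open>The \<open>n\<close>-th point takes care of the first \<open>n + 1\<close>
    functionals of an enumeration of \<open>A\<close>. For empty \<open>A\<close> the enumeration
    takes an unspecified value, which merely adds a condition.\<close>
  have "\<forall>n s. \<exists>x. norm x \<le> 1
      \<and> norm s + real (Suc n) - d n \<le> norm (s + real (Suc n) *\<^sub>R blinfun_apply G x)
      \<and> (\<forall>h \<in> from_nat_into A ` {..n}. \<bar>blinfun_apply h x - blinfun_apply u h\<bar> \<le> d n)"
  proof (intro allI)
    fix n s
    obtain x where "norm x \<le> 1"
      "norm s + real (Suc n) - d n \<le> norm (s + real (Suc n) *\<^sub>R blinfun_apply G x)"
      "\<And>h. h \<in> from_nat_into A ` {..n} \<Longrightarrow> \<bar>blinfun_apply h x - blinfun_apply u h\<bar> \<le> d n"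
      by (rule daugavet_center_weak_neighbourhood[OF G u, of "from_nat_into A ` {..n}" "real (Suc n)" "d n" s])
        (use d in auto)
    then show "\<exists>x. norm x \<le> 1
      \<and> norm s + real (Suc n) - d n \<le> norm (s + real (Suc n) *\<^sub>R blinfun_apply G x)
      \<and> (\<forall>h \<in> from_nat_into A ` {..n}. \<bar>blinfun_apply h x - blinfun_apply u h\<bar> \<le> d n)"
      by blast
  qed
  \<comment> \<open>The choice is made for every \<open>s\<close>, since the \<open>n\<close>-th
    point has to suit the partial sum \<open>s n\<close> built from the earlier points.\<close>
  then obtain X where X: "\<And>n s. norm (X n s) \<le> 1"
      "\<And>n s. norm s + real (Suc n) - d n \<le> norm (s + real (Suc n) *\<^sub>R blinfun_apply G (X n s))"
      "\<And>n s h. h \<in> from_nat_into A ` {..n} \<Longrightarrow> \<bar>blinfun_apply h (X n s) - blinfun_apply u h\<bar> \<le> d n"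
    by metis
  define s where "s = rec_nat y (\<lambda>n s. s + real (Suc n) *\<^sub>R blinfun_apply G (X n s))"
  define x where "x = (\<lambda>n. X n (s n))"
  have s_Suc: "s (Suc n) = s n + real (Suc n) *\<^sub>R blinfun_apply G (x n)" for n
    by (simp add: s_def x_def)
  have s: "s N = y + (\<Sum>n<N. real (Suc n) *\<^sub>R blinfun_apply G (x n))" for N
    by (induction N) (simp_all add: s_Suc add.assoc, simp add: s_def)
  have norm_s: "norm y + (\<Sum>n<N. real (Suc n)) - e * (1 - 1 / 2 ^ N) \<le> norm (s N)" for N
  proof (induction N)
    case 0
    then show ?case by (simp add: s_def)
  next
    case (Suc N)
    have "norm (s N) + real (Suc N) - d N \<le> norm (s (Suc N))"
      using X(2)[of "s N" N] by (simp add: s_Suc x_def)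
    moreover have "e * (1 - 1 / 2 ^ Suc N) = e * (1 - 1 / 2 ^ N) + d N"
      by (simp add: d_def field_simps)
    ultimately show ?case using Suc by simp
  qed
  have x: "norm (x n) \<le> 1" for n by (simp add: x_def X)
  have Gx: "norm (blinfun_apply G (x n)) \<le> 1" for n
    using norm_blinfun_le[of G "x n"] x[of n] G by simp
  have fin: "\<exists>f. norm f \<le> 1 \<and> norm y - e \<le> blinfun_apply f y \<and>
      (\<forall>n<N. 1 - e / real (Suc n) \<le> blinfun_apply f (blinfun_apply G (x n)))" for N
  proof -
    obtain f :: "'b dual" where f: "norm f \<le> 1" "blinfun_apply f (s N) = norm (s N)"
      using norming_functional by blast
    define b where "b = (\<lambda>n. real (Suc n) * (1 - blinfun_apply f (blinfun_apply G (x n))))"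
    have b: "0 \<le> b n" for n
      unfolding b_def using dual_ball_apply_le[OF f(1), of "blinfun_apply G (x n)"] Gx[of n]
      by (intro mult_nonneg_nonneg) auto
    have "blinfun_apply f (s N) = blinfun_apply f y + (\<Sum>n<N. real (Suc n)) - (\<Sum>n<N. b n)"
      by (simp add: s b_def blinfun.add_right blinfun.sum_right blinfun.scaleR_right
          right_diff_distrib sum_subtractf del: of_nat_Suc)
    moreover have "e * (1 - 1 / 2 ^ N) \<le> e"
      using e by (simp add: mult_left_le)
    ultimately have *: "norm y - blinfun_apply f y + (\<Sum>n<N. b n) \<le> e"
      using norm_s[of N] f(2) by linarith
    have "norm y - e \<le> blinfun_apply f y"
      using * sum_nonneg[of "{..<N}" b] b by simp
    moreover have "1 - e / real (Suc n) \<le> blinfun_apply f (blinfun_apply G (x n))" if "n < N" for n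
    proof -
      have "b n \<le> (\<Sum>n<N. b n)"
        using that b by (intro member_le_sum) auto
      then have "b n \<le> e"
        using * dual_ball_apply_le[OF f(1), of y] by linarith
      then show ?thesis by (simp add: b_def field_simps)
    qed
    ultimately show ?thesis using f(1) by blast
  qed
  \<comment> \<open>The index \<open>None\<close> carries the condition at \<open>y\<close>, and
    \<open>Some n\<close> the condition at \<open>G (x n)\<close>.\<close>
  let ?z = "case_option y (\<lambda>n. blinfun_apply G (x n))"
  let ?C = "case_option {norm y - e..} (\<lambda>n. {1 - e / real (Suc n)..})"
  have "\<exists>f \<in> cball (0 :: 'b dual) 1. \<forall>i\<in>UNIV. blinfun_apply f (?z i) \<in> ?C i"
  proof (rule Banach_Alaoglu_fip)
    show "closed (?C i)" for i by (auto split: option.split)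
    fix F :: "nat option set" assume "finite F"
    then have "finite (Some -` F)" by (intro finite_vimageI) auto
    then obtain N where N: "\<And>n. Some n \<in> F \<Longrightarrow> n < N"
      by (auto simp: finite_nat_set_iff_bounded)
    obtain f :: "'b dual" where "norm f \<le> 1" "norm y - e \<le> blinfun_apply f y"
        "\<forall>n<N. 1 - e / real (Suc n) \<le> blinfun_apply f (blinfun_apply G (x n))"
      using fin by blast
    then show "\<exists>f \<in> cball (0 :: 'b dual) 1. \<forall>i\<in>F. blinfun_apply f (?z i) \<in> ?C i"
      using N by (intro bexI[of _ f]) (auto split: option.split)
  qed
  then obtain f :: "'b dual" where f: "norm f \<le> 1"
    and f_case: "\<And>i. blinfun_apply f (?z i) \<in> ?C i" by auto
  obtain w :: "'a bidual" where w: "norm w \<le> 1"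
    "\<And>h c. (\<lambda>n. blinfun_apply h (x n)) \<longlonglongrightarrow> c \<Longrightarrow> blinfun_apply w h = c"
    using bidual_cluster_point[of x] x by blast
  have "d = (\<lambda>n. e * (1 / 2) ^ Suc n)"
    by (simp add: d_def power_divide)
  moreover have "(\<lambda>n. e * (1 / 2) ^ Suc n) \<longlonglongrightarrow> 0"
    by (intro tendsto_mult_right_zero LIMSEQ_Suc LIMSEQ_power_zero) simp
  ultimately have "d \<longlonglongrightarrow> 0" by simp
  have "blinfun_apply w h = blinfun_apply u h" if h: "h \<in> A" for h
  proof (rule w(2))
    obtain k where k: "h = from_nat_into A k"
      using subset_range_from_nat_into[OF A] h by blast
    have "\<forall>\<^sub>F n in sequentially. norm (blinfun_apply h (x n) - blinfun_apply u h) \<le> d n"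
      using eventually_ge_at_top[of k]
      by eventually_elim (auto simp: k x_def intro!: X(3))
    then have "(\<lambda>n. blinfun_apply h (x n) - blinfun_apply u h) \<longlonglongrightarrow> 0"
      using \<open>d \<longlonglongrightarrow> 0\<close> by (rule Lim_null_comparison)
    then show "(\<lambda>n. blinfun_apply h (x n)) \<longlonglongrightarrow> blinfun_apply u h"
      by (simp add: LIM_zero_iff)
  qed
  moreover have "blinfun_apply w (f o\<^sub>L G) = 1"
  proof (rule w(2), rule tendsto_sandwich)
    show "\<forall>\<^sub>F n in sequentially. 1 - e / real (Suc n) \<le> blinfun_apply (f o\<^sub>L G) (x n)"
      using f_case[of "Some _"] by (intro always_eventually) simp
    show "\<forall>\<^sub>F n in sequentially. blinfun_apply (f o\<^sub>L G) (x n) \<le> 1"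
      using order_trans[OF dual_ball_apply_le[OF f] Gx] by (intro always_eventually allI) simp
    show "(\<lambda>n. 1 - e / real (Suc n)) \<longlonglongrightarrow> 1"
      using tendsto_diff[OF tendsto_const[of 1] tendsto_mult_left[OF LIMSEQ_inverse_real_of_nat, of e]]
      by (simp add: divide_inverse)
  qed simp
  moreover have "norm y - e \<le> blinfun_apply f y" using f_case[of None] by simp
  ultimately show thesis
    using f w(1) by (intro that)
qed

subsection \<open>Transfinite recursion\<close>

text \<open>Here the cardinal \<omega>1 enters: \<open>|J|\<close> is a well-order of minimal type,
  so its proper initial segments have cardinality below the successor of
  \<open>natLeq\<close>.\<close>

lemma card_order_underS_countable:
  assumes "|J| \<le>o omega_1" "i \<in> J"
  shows "countable (underS (card_of J) i)"
proof -
  have "card_of (underS (card_of J) i) <o |J|"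
    using assms(2) by (intro card_of_underS card_of_Card_order) (simp add: Field_card_of)
  then have "card_of (underS (card_of J) i) <o cardSuc natLeq"
    using assms(1) ordLess_ordLeq_trans by (auto simp: omega_1_def)
  then show ?thesis
    by (simp add: countable_card_le_natLeq cardSuc_ordLeq_ordLess natLeq_Card_order card_of_Card_order)
qed

text \<open>Used to reduce finitely many stages of the recursion to the latest one.\<close>

lemma finite_linear_order_has_max:
  assumes r: "linear_order_on J r" and K: "finite K" "K \<noteq> {}" "K \<subseteq> J"
  obtains m where "m \<in> K" "\<And>e. e \<in> K \<Longrightarrow> (e, m) \<in> r"
proof -
  have refl: "(e, e) \<in> r" if "e \<in> J" for e
    using r that by (auto simp: order_on_defs refl_on_def)
  have "\<exists>m\<in>K. \<forall>e\<in>K. (e, m) \<in> r"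
    using K
  proof (induction K rule: finite_ne_induct)
    case (singleton e)
    then show ?case using refl by auto
  next
    case (insert e K)
    then obtain m where m: "m \<in> K" "\<forall>e\<in>K. (e, m) \<in> r" by auto
    have J: "e \<in> J" "m \<in> J" using insert.prems m(1) by auto
    have "total_on J r" "trans r" using r by (simp_all add: order_on_defs)
    show ?case
    proof (cases "(e, m) \<in> r")
      case True
      with m show ?thesis by blast
    next
      case False
      then have "(m, e) \<in> r"
        using \<open>total_on J r\<close> J refl[OF J(1)] by (cases "e = m") (auto simp: total_on_def)
      then have "(i, e) \<in> r" if "i \<in> K" for i
        using m(2) that \<open>trans r\<close> by (blast dest: transD)
      then show ?thesis using refl[OF J(1)] by blast
    qed
  qed
  with that show thesis by blast
qed

section \<open>The biadjoint and the recursion over all vectors\<close>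

lemma norm_biadjoint_le:
  fixes G :: "'a::real_normed_vector \<Rightarrow>\<^sub>L 'b::real_normed_vector"
  shows "norm (blinfun_apply (biadjoint G) w) \<le> norm w * norm G"
proof (rule norm_blinfun_bound)
  fix f :: "'b dual"
  have "norm (blinfun_apply (blinfun_apply (biadjoint G) w) f) \<le> norm w * norm (f o\<^sub>L G)"
    using norm_blinfun[of w "f o\<^sub>L G"] by (simp add: biadjoint_def adjoint_op.rep_eq)
  also have "\<dots> \<le> norm w * (norm f * norm G)"
    by (intro mult_left_mono norm_blinfun_compose) auto
  finally show "norm (blinfun_apply (blinfun_apply (biadjoint G) w) f) \<le> norm w * norm G * norm f"
    by (simp add: ac_simps)
qed simp

lemma biadjoint_apply: "blinfun_apply (blinfun_apply (biadjoint G) w) f = blinfun_apply w (f o\<^sub>L G)"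
  by (simp add: biadjoint_def adjoint_op.rep_eq)

text \<open>
  The transfinite recursion only has to remember one functional per stage: the requirement
  \<open>w (f i \<circ> G) = 1\<close> records exactly that \<open>G\<^sup>*\<^sup>* w\<close> and the vector of stage \<open>i\<close> are almost normed
  by \<open>f i\<close>, and it is closed in the weak-star topology, so that limit stages follow by compactness.
\<close>

lemma daugavet_center_all_vectors:
  fixes G :: "'a::real_normed_vector \<Rightarrow>\<^sub>L 'b::real_normed_vector" and u :: "'a bidual"
    and y :: "'i \<Rightarrow> 'b"
  assumes G: "daugavet_center G" "norm G = 1" and u: "norm u \<le> 1"
    and A: "countable A" and J: "|J| \<le>o omega_1" and e: "\<And>i. i \<in> J \<Longrightarrow> 0 < e i"
  obtains w where "norm w \<le> 1" "\<And>h. h \<in> A \<Longrightarrow> blinfun_apply w h = blinfun_apply u h"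
    "\<And>i. i \<in> J \<Longrightarrow> 1 + norm (y i) - e i \<le> norm (blinfun_apply (biadjoint G) w + canonical_embedding (y i))"
proof -
  define agrees where "agrees = (\<lambda>w. norm w \<le> 1 \<and> (\<forall>h\<in>A. blinfun_apply w h = blinfun_apply u h))"
  \<comment> \<open>Here \<open>f\<close> holds the functionals of earlier stages and
    \<open>g\<close> is the candidate for stage \<open>i\<close>. Outside \<open>J\<close> the
    condition is void, because the recursion ranges over the whole type.\<close>
  define P where "P = (\<lambda>f i g. i \<in> J \<longrightarrow> norm g \<le> 1 \<and> norm (y i) - e i \<le> blinfun_apply g (y i) \<and>
    (\<exists>w. agrees w \<and> blinfun_apply w (g o\<^sub>L G) = 1 \<and>
      (\<forall>j \<in> underS (card_of J) i. blinfun_apply w (f j o\<^sub>L G) = 1)))"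
  have wo: "well_order_on J |J|" by (rule card_of_well_order_on)
  then have lin: "linear_order_on J |J|" and wf: "wf ( |J| - Id)"
    by (auto simp: well_order_on_def)
  have below: "i \<in> J \<and> j \<in> J" if "(i, j) \<in> |J|" for i j
    using FieldI1[OF that] FieldI2[OF that] by (auto simp: Field_card_of)
  have limit: "\<exists>w. agrees w \<and> (\<forall>i\<in>K. blinfun_apply w (f i o\<^sub>L G) = 1)"
    if K: "K \<subseteq> J" "\<And>i. i \<in> K \<Longrightarrow> P f i (f i)" for K f
  proof -
    \<comment> \<open>Agreement with \<open>u\<close> and the requirements of the stages alike
      prescribe the value of \<open>w\<close> at one functional, hence the pairs of a functional and
      a value.\<close>
    let ?I = "(\<lambda>h. (h, blinfun_apply u h)) ` A \<union> (\<lambda>i. (f i o\<^sub>L G, 1)) ` K"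
    have "\<exists>w \<in> cball 0 1. \<forall>p\<in>?I. blinfun_apply w (fst p) \<in> {snd p}"
    proof (rule Banach_Alaoglu_fip)
      fix F assume F: "finite F" "F \<subseteq> ?I"
      obtain K' where K': "finite K'" "K' \<subseteq> K"
          "F \<inter> (\<lambda>i. (f i o\<^sub>L G, 1)) ` K = (\<lambda>i. (f i o\<^sub>L G, 1)) ` K'"
        using finite_subset_image[of "F \<inter> (\<lambda>i. (f i o\<^sub>L G, 1)) ` K" "\<lambda>i. (f i o\<^sub>L G, 1)" K] F(1)
        by auto
      have "\<exists>w. agrees w \<and> (\<forall>i\<in>K'. blinfun_apply w (f i o\<^sub>L G) = 1)"
      proof (cases "K' = {}")
        case True
        then show ?thesis using u by (auto simp: agrees_def)
      next
        case False
        then obtain m where m: "m \<in> K'" "\<And>i. i \<in> K' \<Longrightarrow> (i, m) \<in> |J|"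
          using finite_linear_order_has_max[OF lin K'(1)] K K'(2) by blast
        \<comment> \<open>The witness of the latest stage \<open>m\<close> meets the requirements of
          all stages in \<open>K'\<close>; \<open>underS\<close> omits \<open>m\<close> itself,
          which has its own clause in \<open>P\<close>.\<close>
        have "P f m (f m)" "m \<in> J" using K K' m by auto
        then obtain w where "agrees w" "blinfun_apply w (f m o\<^sub>L G) = 1"
            "\<forall>j \<in> underS (card_of J) m. blinfun_apply w (f j o\<^sub>L G) = 1"
          by (auto simp: P_def)
        with m(2) show ?thesis by (auto simp: underS_def) metis
      qed
      then obtain w where w: "agrees w" "\<forall>i\<in>K'. blinfun_apply w (f i o\<^sub>L G) = 1" by blast
      have "blinfun_apply w (fst p) = snd p" if "p \<in> F" for p
      proof (cases "p \<in> (\<lambda>i. (f i o\<^sub>L G, 1)) ` K")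
        case True
        with that K'(3) have "p \<in> (\<lambda>i. (f i o\<^sub>L G, 1)) ` K'" by blast
        with w show ?thesis by auto
      next
        case False
        with that F w show ?thesis by (auto simp: agrees_def)
      qed
      then show "\<exists>w \<in> cball 0 1. \<forall>p\<in>F. blinfun_apply w (fst p) \<in> {snd p}"
        using w(1) by (intro bexI[of _ w] ballI) (simp_all add: agrees_def)
    qed simp
    then obtain w where "norm w \<le> 1" "\<forall>p\<in>?I. blinfun_apply w (fst p) = snd p" by auto
    then show ?thesis by (intro exI[of _ w]) (simp add: agrees_def ball_Un)
  qed
  have "\<exists>f. \<forall>i. P f i (f i)"
  proof (rule dependent_wf_choice[OF wf])
    fix f g :: "'i \<Rightarrow> 'b dual" and i h
    assume "\<And>j. (j, i) \<in> |J| - Id \<Longrightarrow> f j = g j"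
    then have "\<And>j. j \<in> underS (card_of J) i \<Longrightarrow> f j = g j" by (auto simp: underS_def)
    then show "P f i h = P g i h" by (simp add: P_def)
  next
    fix i and f :: "'i \<Rightarrow> 'b dual"
    assume IH: "\<And>j. (j, i) \<in> |J| - Id \<Longrightarrow> P f j (f j)"
    show "\<exists>h. P f i h"
    proof (cases "i \<in> J")
      case False
      then show ?thesis by (simp add: P_def)
    next
      case True
      let ?U = "underS (card_of J) i"
      have "P f j (f j)" if "j \<in> ?U" for j
        using that by (intro IH) (auto simp: underS_def)
      moreover have "?U \<subseteq> J" using below by (auto simp: underS_def)
      ultimately obtain w0 where w0: "agrees w0" "\<forall>j \<in> ?U. blinfun_apply w0 (f j o\<^sub>L G) = 1"
        using limit by blast
      \<comment> \<open>Only countably many values are fixed so far, so the new \<open>w\<close> can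
        keep all values that \<open>w0\<close> has on this set.\<close>
      have cnt: "countable (A \<union> (\<lambda>j. f j o\<^sub>L G) ` ?U)"
        using A card_order_underS_countable[OF J True] by simp
      have "norm w0 \<le> 1" using w0 by (simp add: agrees_def)
      from daugavet_center_single_vector[OF G this cnt e[OF True], of "y i"]
      obtain h w where "norm h \<le> 1" "norm (y i) - e i \<le> blinfun_apply h (y i)" "norm w \<le> 1"
          "\<And>g. g \<in> A \<union> (\<lambda>j. f j o\<^sub>L G) ` ?U \<Longrightarrow> blinfun_apply w g = blinfun_apply w0 g"
          "blinfun_apply w (h o\<^sub>L G) = 1"
        by metis
      with w0 have "P f i h"
        by (auto simp: P_def agrees_def intro!: exI[of _ w])
      then show ?thesis ..
    qed
  qed
  then obtain f where f: "\<And>i. P f i (f i)" by blast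
  then obtain w where w: "agrees w" "\<And>i. i \<in> J \<Longrightarrow> blinfun_apply w (f i o\<^sub>L G) = 1"
    using limit[of J f] by auto
  show thesis
  proof (rule that)
    fix i assume i: "i \<in> J"
    have "1 + norm (y i) - e i \<le> 1 + blinfun_apply (f i) (y i)"
      using f[of i] i by (simp add: P_def)
    also have "\<dots> = blinfun_apply (blinfun_apply (biadjoint G) w + canonical_embedding (y i)) (f i)"
      using w(2)[OF i] by (simp add: plus_blinfun.rep_eq biadjoint_apply canonical_embedding.rep_eq)
    also have "\<dots> \<le> norm (blinfun_apply (biadjoint G) w + canonical_embedding (y i)) * norm (f i)"
      using norm_blinfun[of "blinfun_apply (biadjoint G) w + canonical_embedding (y i)" "f i"] by simp
    also have "\<dots> \<le> norm (blinfun_apply (biadjoint G) w + canonical_embedding (y i))"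
      using f[of i] i by (simp add: P_def mult_left_le)
    finally show "1 + norm (y i) - e i \<le> norm (blinfun_apply (biadjoint G) w + canonical_embedding (y i))" .
  qed (use w in \<open>auto simp: agrees_def\<close>)
qed

section \<open>L-orthogonal elements and weak-star open sets\<close>

lemma canonical_embedding_diff: "canonical_embedding (x - y) = canonical_embedding x - canonical_embedding y"
  by (rule blinfun_eqI)
    (simp add: canonical_embedding.rep_eq minus_blinfun.rep_eq blinfun.diff_right)

text \<open>The stages are pairs of a vector of a dense set \<open>D\<close> and an error
  \<open>1 / (n + 1)\<close>. The errors tend to 0 at each vector of \<open>D\<close>, and Lipschitz
  continuity carries the equality to all of the space.\<close>

lemma daugavet_center_L_orthogonal:
  fixes G :: "'a::real_normed_vector \<Rightarrow>\<^sub>L 'b::real_normed_vector" and u :: "'a bidual"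
  assumes G: "daugavet_center G" "norm G = 1"
    and dens: "has_density_character (UNIV :: 'b set) omega_1"
    and u: "norm u \<le> 1" and A: "countable A"
  obtains w where "norm w \<le> 1" "\<And>h. h \<in> A \<Longrightarrow> blinfun_apply w h = blinfun_apply u h"
    "\<And>y. norm (blinfun_apply (biadjoint G) w + canonical_embedding y) = 1 + norm y"
proof -
  obtain D :: "'b set" where D: "closure D = UNIV" "|D| =o omega_1"
    using dens by (auto simp: has_density_character_def)
  have "natLeq \<le>o omega_1"
    by (simp add: omega_1_def cardSuc_ordLeq natLeq_Card_order)
  \<comment> \<open>Since \<open>D\<close> is infinite, pairing it with the natural numbers does not
    enlarge its cardinality.\<close>
  then have nat_le: "|UNIV :: nat set| \<le>o |D|"
    using card_of_nat D(2) by (meson ordIso_ordLeq_trans ordIso_symmetric ordLeq_ordIso_trans)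
  then have "infinite D" by (simp add: infinite_iff_card_of_nat)
  then have "|D \<times> (UNIV :: nat set)| =o |D|"
    using nat_le by (intro card_of_Times_infinite_simps) auto
  then have J: "|D \<times> (UNIV :: nat set)| \<le>o omega_1"
    using D(2) by (meson ordIso_iff_ordLeq ordIso_transitive)
  from daugavet_center_all_vectors[OF G u A J, where y = fst and e = "\<lambda>i. 1 / real (Suc (snd i))"]
  obtain w where w: "norm w \<le> 1" "\<And>h. h \<in> A \<Longrightarrow> blinfun_apply w h = blinfun_apply u h"
    and ge: "\<And>i. i \<in> D \<times> UNIV \<Longrightarrow> 1 + norm (fst i) - 1 / real (Suc (snd i)) \<le>
      norm (blinfun_apply (biadjoint G) w + canonical_embedding (fst i))"
    by (metis of_nat_0_less_iff zero_less_Suc zero_less_divide_1_iff)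
  define q where "q = (\<lambda>y. norm (blinfun_apply (biadjoint G) w + canonical_embedding y))"
  have geD: "1 + norm y \<le> q y" if "y \<in> D" for y
  proof (rule field_le_epsilon)
    fix e :: real assume "0 < e"
    then obtain n where "1 / real (Suc n) < e" using nat_approx_posE by blast
    then show "1 + norm y \<le> q y + e" using ge[of "(y, n)"] that by (simp add: q_def)
  qed
  have q_lip: "q z \<le> q y + norm (z - y)" for y z
  proof -
    have "q z \<le> q y + norm (canonical_embedding (z - y))"
      unfolding q_def canonical_embedding_diff
      using norm_triangle_ineq[of "blinfun_apply (biadjoint G) w + canonical_embedding y"
          "canonical_embedding z - canonical_embedding y"] by simp
    then show ?thesis using norm_canonical_embedding_le[of "z - y"] by simp
  qed
  have "q y = 1 + norm y" for y
  proof (rule antisym)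
    have "norm (blinfun_apply (biadjoint G) w) \<le> 1"
      using norm_biadjoint_le[of G w] w(1) G(2) by simp
    then show "q y \<le> 1 + norm y"
      unfolding q_def using norm_canonical_embedding_le[of y]
      by (intro norm_triangle_le) auto
    show "1 + norm y \<le> q y"
    proof (rule field_le_epsilon)
      fix e :: real assume "0 < e"
      moreover have "y \<in> closure D" using D by simp
      ultimately obtain z where z: "z \<in> D" "dist z y < e / 2"
        by (meson closure_approachable half_gt_zero)
      have "norm y \<le> norm z + norm (z - y)"
        using norm_triangle_ineq3[of z y] by linarith
      then show "1 + norm y \<le> q y + e"
        using geD[OF z(1)] q_lip[of z y] z(2) by (simp add: dist_norm)
    qed
  qed
  with w that show thesis by (auto simp: q_def)
qed

text \<open>A basic neighbourhood of \<open>u\<close> in the product topology restricts only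
  finitely many coordinates, so exact agreement with \<open>u\<close> there is enough.\<close>

lemma weak_star_open_contains_agreeing:
  assumes "openin weak_star_topology U" "u \<in> U"
  obtains A where "finite A"
    "\<And>v. (\<And>h. h \<in> A \<Longrightarrow> blinfun_apply v h = blinfun_apply u h) \<Longrightarrow> v \<in> U"
proof -
  obtain V where V: "open V" "U = blinfun_apply -` V"
    using assms(1) by (auto simp: strong_operator_topology_def openin_pullback_topology)
  then have "openin (product_topology (\<lambda>_. euclidean) UNIV) V"
    by (simp add: euclidean_product_topology)
  from product_topology_open_contains_basis[OF this, of "blinfun_apply u"] assms(2) V
  obtain X where X: "blinfun_apply u \<in> (\<Pi>\<^sub>E i\<in>UNIV. X i)" "finite {i. X i \<noteq> UNIV}"
      "(\<Pi>\<^sub>E i\<in>UNIV. X i) \<subseteq> V"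
    by auto
  show thesis
  proof (rule that[OF X(2)])
    fix v assume *: "\<And>h. h \<in> {i. X i \<noteq> UNIV} \<Longrightarrow> blinfun_apply v h = blinfun_apply u h"
    have "blinfun_apply v i \<in> X i" for i
      using X(1) *[of i] by (cases "X i = UNIV") auto
    then show "v \<in> U" using X(3) V by auto
  qed
qed

theorem theorem3p6:
  fixes G :: "'a::banach \<Rightarrow>\<^sub>L 'b::banach"
  assumes "daugavet_center G"
    and "norm G = 1"
    and "separable_space (top_of_set (range (blinfun_apply G)))"
    and "has_density_character (UNIV :: 'b set) omega_1"
  shows "(\<forall>(u :: 'a bidual) \<in> cball 0 1. \<forall>g :: nat \<Rightarrow> 'a dual. range g \<subseteq> sphere 0 1 \<longrightarrow>
            (\<exists>v \<in> cball 0 1.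
               (\<forall>n. blinfun_apply v (g n) = blinfun_apply u (g n)) \<and>
               (\<forall>y :: 'b. norm (blinfun_apply (biadjoint G) v + canonical_embedding y) = 1 + norm y)))
       \<and> (\<forall>W :: 'a bidual set.
            openin (subtopology weak_star_topology (cball 0 1)) W \<and> W \<noteq> {} \<longrightarrow>
            (\<exists>v \<in> W.
               \<forall>y :: 'b. norm (blinfun_apply (biadjoint G) v + canonical_embedding y) = 1 + norm y))"
proof (intro conjI ballI allI impI)
  fix u :: "'a bidual" and g :: "nat \<Rightarrow> 'a dual"
  assume "u \<in> cball 0 1"
  then have u: "norm u \<le> 1" by simp
  obtain w where "norm w \<le> 1" "\<And>h. h \<in> range g \<Longrightarrow> blinfun_apply w h = blinfun_apply u h"
      "\<And>y. norm (blinfun_apply (biadjoint G) w + canonical_embedding y) = 1 + norm y"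
    using daugavet_center_L_orthogonal[OF assms(1,2,4) u, of "range g"] by auto
  then show "\<exists>v \<in> cball 0 1.
      (\<forall>n. blinfun_apply v (g n) = blinfun_apply u (g n)) \<and>
      (\<forall>y :: 'b. norm (blinfun_apply (biadjoint G) v + canonical_embedding y) = 1 + norm y)"
    by (intro bexI[of _ w]) auto
next
  fix W :: "'a bidual set"
  assume W: "openin (subtopology weak_star_topology (cball 0 1)) W \<and> W \<noteq> {}"
  then obtain U where U: "openin weak_star_topology U" "W = U \<inter> cball 0 1"
    by (auto simp: openin_subtopology)
  \<comment> \<open>Any point of \<open>W\<close> can serve as \<open>u\<close>: a \<open>w\<close>
    in the ball that agrees with it on the finite set \<open>A\<close> lies in \<open>W\<close>
    again.\<close>
  obtain u where u: "u \<in> U" "norm u \<le> 1" using W U by auto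
  obtain A where A: "finite A"
      "\<And>v. (\<And>h. h \<in> A \<Longrightarrow> blinfun_apply v h = blinfun_apply u h) \<Longrightarrow> v \<in> U"
    using weak_star_open_contains_agreeing[OF U(1) u(1)] by blast
  obtain w where "norm w \<le> 1" "\<And>h. h \<in> A \<Longrightarrow> blinfun_apply w h = blinfun_apply u h"
      "\<And>y. norm (blinfun_apply (biadjoint G) w + canonical_embedding y) = 1 + norm y"
    using daugavet_center_L_orthogonal[OF assms(1,2,4) u(2) countable_finite[OF A(1)]] by blast
  then show "\<exists>v \<in> W. \<forall>y :: 'b. norm (blinfun_apply (biadjoint G) v + canonical_embedding y) = 1 + norm y"
    using U(2) A(2) by (intro bexI[of _ w]) auto
qed

end
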